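(* Let $G$ be a strongly uncontrollable graph on $n$ vertices $v_1,\ldots,v_n$ with Laplacian matrix $L$. Let $\widetilde{G}$ be the graph on $n+1$ vertices obtained from $G$ by adding a vertex $v_{n+1}$ and connecting it to all the vertices of $G$. Then $\widetilde{G}$ is a strongly uncontrollable graph if and only if the spectral radius of $L$ is less than $n$. In this case, $\mathrm{Aut}(G)$ and $\mathrm{Aut}(\widetilde{G})$ are equal when viewed as subgroups of the symmetric group $S_{n+1}$.
   Context: Graphs are finite, simple and undirected. The Laplacian matrix of a graph is $L=D-A$, where $A$ is the adjacency matrix and $D$ the diagonal degree matrix. A matrix has simple spectrum if every eigenvalue has algebraic multiplicity one. For $L\in\mathbb{R}^{n\times n}$ and $b\in\mathbb{R}^n$, $(L,b)$ is controllable if $\mathrm{span}\{b,Lb,\ldots,L^{n-1}b\}=\mathbb{R}^n$, and uncontrollable otherwise. A simple connected graph $G$ on $n$ vertices is strongly uncontrollable if its Laplacian $L$ has simple spectrum and $(L,b)$ is uncontrollable for every $b\in\{0,1\}^n$. $\mathrm{Aut}(\cdot)$ is the group of graph automorphisms (vertex permutations preserving adjacency in both directions), viewed as permutations of indices; $\mathrm{Aut}(G)$ is viewed as a subgroup of $S_{n+1}$ by letting each automorphism of $G$ fix $n+1$. *)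

theory Defs
  imports
    "Graph_Theory.Graph_Theory"
    "Jordan_Normal_Form.Spectral_Radius"
    "Jordan_Normal_Form.VS_Connect"
    "HOL-Algebra.Sym_Groups"
begin

text \<open>A finite simple undirected graph is a \<^locale>\<open>pair_graph\<close>: a finite, loop-free, symmetric arc
  relation.  A graph on the vertices \<open>v\<^sub>1, \<dots>, v\<^sub>n\<close> has vertex set \<open>{1..n}\<close>, the set permuted by
  \<^const>\<open>sym_group\<close>.  Matrices are indexed from \<open>0\<close>, so row \<open>i\<close> belongs to the vertex \<open>Suc i\<close>.\<close>

definition graph_on :: "nat \<Rightarrow> nat pair_pre_digraph \<Rightarrow> bool" where
  "graph_on n G \<longleftrightarrow> pair_graph G \<and> pverts G = {1..n}"

definition adjacency_mat :: "nat \<Rightarrow> nat pair_pre_digraph \<Rightarrow> real mat" where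
  "adjacency_mat n G = mat n n (\<lambda>(i, j). if (Suc i, Suc j) \<in> parcs G then 1 else 0)"

definition degree_mat :: "nat \<Rightarrow> nat pair_pre_digraph \<Rightarrow> real mat" where
  "degree_mat n G =
     mat n n (\<lambda>(i, j). if i = j then real (out_degree (with_proj G) (Suc i)) else 0)"

definition laplacian_mat :: "nat \<Rightarrow> nat pair_pre_digraph \<Rightarrow> real mat" where
  "laplacian_mat n G = degree_mat n G - adjacency_mat n G"

abbreviation complex_mat :: "real mat \<Rightarrow> complex mat" where
  "complex_mat \<equiv> map_mat complex_of_real"

text \<open>Eigenvalues of a real matrix are taken over the complex numbers; the order of a root of the
  characteristic polynomial is its algebraic multiplicity.\<close>

definition simple_spectrum :: "real mat \<Rightarrow> bool" where
  "simple_spectrum A \<longleftrightarrow>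
     (\<forall>k. eigenvalue (complex_mat A) k \<longrightarrow> Polynomial.order k (char_poly (complex_mat A)) = 1)"

definition controllable :: "nat \<Rightarrow> real mat \<Rightarrow> real vec \<Rightarrow> bool" where
  "controllable n A b \<longleftrightarrow>
     LinearCombinations.module.span class_ring (module_vec TYPE(real) n)
       {(A ^\<^sub>m k) *\<^sub>v b |k. k < n} = carrier_vec n"

definition strongly_uncontrollable :: "nat \<Rightarrow> nat pair_pre_digraph \<Rightarrow> bool" where
  "strongly_uncontrollable n G \<longleftrightarrow>
     graph_on n G \<and> Digraph_Component.connected (with_proj G) \<and>
     simple_spectrum (laplacian_mat n G) \<and>
     (\<forall>b \<in> carrier_vec n. (\<forall>i < n. b $ i \<in> {0, 1}) \<longrightarrow> \<not> controllable n (laplacian_mat n G) b)"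

definition cone :: "nat \<Rightarrow> nat pair_pre_digraph \<Rightarrow> nat pair_pre_digraph" where
  "cone n G = \<lparr> pverts = insert (n + 1) (pverts G),
     parcs = parcs G \<union> pverts G \<times> {n + 1} \<union> {n + 1} \<times> pverts G \<rparr>"

text \<open>By definition of \<^const>\<open>permutes\<close>, an automorphism is a permutation of all natural numbers that
  fixes every number outside the vertex set.  Thus for a graph on \<open>{1..n}\<close> the elements of
  \<open>Aut G\<close> fix \<open>n + 1\<close>, and \<open>Aut G\<close> is literally a subgroup of \<open>sym_group (n + 1)\<close>.\<close>

definition Aut :: "'a pair_pre_digraph \<Rightarrow> ('a \<Rightarrow> 'a) set" where
  "Aut G = {p. p permutes pverts G \<and>
     (\<forall>u \<in> pverts G. \<forall>v \<in> pverts G. (u, v) \<in> parcs G \<longleftrightarrow> (p u, p v) \<in> parcs G)}"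

lemma graph_on_cone:
  assumes "graph_on n G"
  shows "graph_on (n + 1) (cone n G)"
proof -
  have G: "pair_graph G" and V: "pverts G = {1..n}" using assms by (simp_all add: graph_on_def)
  interpret pair_graph G by (rule G)
  have s: "(v, u) \<in> parcs G" if "(u, v) \<in> parcs G" for u v
    using pair_sym_arcs that unfolding symmetric_def by (simp add: sym_def)
  have w: "fst e \<in> pverts (cone n G)" "snd e \<in> pverts (cone n G)" "fst e \<noteq> snd e"
    if "e \<in> parcs (cone n G)" for e
    using that V arc_fst_in_verts[of e] arc_snd_in_verts[of e] pair_no_loops[of e]
    by (cases e; auto simp: cone_def)+
  have "pair_graph (cone n G)"
  proof
    show "symmetric (with_proj (cone n G))"
      using s unfolding symmetric_def by (auto simp: cone_def sym_def)
    show "finite (pverts (cone n G))" "finite (parcs (cone n G))"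
      using V pair_finite_arcs by (simp_all add: cone_def)
  qed (use w in blast)+
  then show ?thesis using V by (auto simp: graph_on_def cone_def)
qed

lemma Aut_subgroup:
  assumes G: "graph_on m G" and "m \<le> n"
  shows "subgroup (Aut G) (sym_group n)"
proof -
  have V: "pverts G = {1..m}" using G by (simp add: graph_on_def)
  have perm: "p permutes {1..n}" if "p permutes {1..m}" for p
    using permutes_subset[OF that] \<open>m \<le> n\<close> by auto
  have inv: "inv' p \<in> Aut G" if "p \<in> Aut G" for p
  proof -
    have p: "p permutes {1..m}" using that V by (simp add: Aut_def)
    have "(u, v) \<in> parcs G \<longleftrightarrow> (inv' p u, inv' p v) \<in> parcs G"
      if "u \<in> {1..m}" "v \<in> {1..m}" for u v
    proof -
      have "inv' p u \<in> {1..m}" "inv' p v \<in> {1..m}"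
        using that permutes_in_image[OF permutes_inv[OF p]] by auto
      then show ?thesis
        using \<open>p \<in> Aut G\<close> V permutes_inverses(1)[OF p] by (auto simp: Aut_def)
    qed
    then show ?thesis using V permutes_inv[OF p] by (simp add: Aut_def)
  qed
  show ?thesis
  proof (rule group.subgroupI[OF sym_group_is_group])
    show "Aut G \<subseteq> carrier (sym_group n)"
      using V perm by (auto simp: Aut_def sym_group_def)
    have "id \<in> Aut G" by (simp add: Aut_def permutes_id)
    then show "Aut G \<noteq> {}" by blast
  next
    fix p assume "p \<in> Aut G"
    moreover from this have "p \<in> carrier (sym_group n)"
      using V perm by (auto simp: Aut_def sym_group_def)
    ultimately show "inv\<^bsub>sym_group n\<^esub> p \<in> Aut G"
      using inv sym_group_inv_equality by metis
  next
    fix p q assume p: "p \<in> Aut G" and q: "q \<in> Aut G"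
    have "p \<circ> q permutes pverts G"
      using p q permutes_compose[of q "pverts G" p] by (simp add: Aut_def)
    moreover have "q u \<in> pverts G" if "u \<in> pverts G" for u
      using q that permutes_in_image[of q "pverts G" u] by (simp add: Aut_def)
    ultimately show "p \<otimes>\<^bsub>sym_group n\<^esub> q \<in> Aut G"
      using p q by (simp add: Aut_def sym_group_mult)
  qed
qed

end

theory Submission
  imports Defs
begin

text \<open>Write \<open>L\<close> for the Laplacian of \<open>G\<close> and \<open>L'\<close> for that of the cone.  If \<open>u\<close> has entry sum
  \<open>0\<close>, then \<open>L'\<close> maps \<open>(u, 0)\<close> to \<open>(L u + u, 0)\<close>: coning shifts the spectrum of \<open>L\<close> on the
  hyperplane orthogonal to the constants by \<open>1\<close>, and adds the eigenvalues \<open>0\<close> (constants) and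
  \<open>n + 1\<close> (the vector \<open>(1, \<dots>, 1, - n)\<close>).  Everything follows from this picture.

  Simplicity of the spectrum.  On characteristic polynomials the picture reads
  \<open>(x - 1) \<chi>\<^sub>L\<^sub>' x = x (x - (n + 1)) \<chi>\<^sub>L (x - 1)\<close> (lemma \<open>char_poly_laplacian_cone\<close>).  Comparing root
  orders, the only possible collision is at \<open>n + 1\<close>, and it happens exactly when \<open>n\<close> is an eigenvalue
  of \<open>L\<close> (\<open>simple_spectrum_cone_iff\<close>).  Since the eigenvalues of \<open>L\<close> lie in the interval from \<open>0\<close> to
  \<open>n\<close> (\<open>laplacian_eigenvalue_bounds\<close>), excluding \<open>n\<close> is the same as having spectral radius below \<open>n\<close>.

  Uncontrollability passes to the cone without a spectral condition (\<open>uncontrollable_cone\<close>).  By the criterion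
  \<open>uncontrollable_iff_orthogonal\<close>, a pair \<open>(L, b)\<close> is uncontrollable iff some \<open>w \<noteq> 0\<close> is orthogonal to
  every \<open>L\<^sup>k b\<close>.  Then \<open>L w\<close> has the same property and entry sum \<open>0\<close>, so \<open>(L w, 0)\<close> witnesses
  uncontrollability of the cone for either choice of the last input entry.  This fails only if
  \<open>L w = 0\<close>, that is, if \<open>w\<close> is constant; but then orthogonality to \<open>b\<close> and \<open>b \<ge> 0\<close> force \<open>b = 0\<close>, and
  any nonconstant \<open>w\<close> may be used instead.

  Automorphisms.  An automorphism of the cone that moves the apex turns some vertex of \<open>G\<close> into a
  neighbour of all others, and such a vertex makes \<open>n\<close> an eigenvalue of \<open>L\<close>
  (\<open>universal_vertex_eigenvalue\<close>).  When \<open>n\<close> is not an eigenvalue, the apex is therefore fixed and the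
  automorphism restricts to \<open>G\<close>.\<close>

section \<open>Controllability\<close>

lemma pow_mat_Suc_mult_vec:
  fixes A :: "'a :: comm_semiring_1 mat"
  assumes A: "A \<in> carrier_mat n n" and v: "v \<in> carrier_vec n"
  shows "A ^\<^sub>m Suc k *\<^sub>v v = A *\<^sub>v (A ^\<^sub>m k *\<^sub>v v)"
  using v
proof (induction k arbitrary: v)
  case 0
  then show ?case using A by simp
next
  case (Suc k)
  have Ak: "A ^\<^sub>m m \<in> carrier_mat n n" for m using A by simp
  have step: "A ^\<^sub>m Suc m *\<^sub>v v = A ^\<^sub>m m *\<^sub>v (A *\<^sub>v v)" for m
    using assoc_mult_mat_vec[OF Ak A Suc.prems] by simp
  have "A ^\<^sub>m Suc (Suc k) *\<^sub>v v = A ^\<^sub>m Suc k *\<^sub>v (A *\<^sub>v v)" by (rule step)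
  also have "\<dots> = A *\<^sub>v (A ^\<^sub>m k *\<^sub>v (A *\<^sub>v v))" using A Suc.prems by (intro Suc.IH) simp
  also have "\<dots> = A *\<^sub>v (A ^\<^sub>m Suc k *\<^sub>v v)" by (simp only: step)
  finally show ?case .
qed

lemma scalar_prod_symmetric_mat:
  fixes A :: "'a :: comm_semiring_0 mat"
  assumes A: "A \<in> carrier_mat n n" and sym: "transpose_mat A = A"
    and u: "u \<in> carrier_vec n" and v: "v \<in> carrier_vec n"
  shows "(A *\<^sub>v u) \<bullet> v = u \<bullet> (A *\<^sub>v v)"
  using transpose_vec_mult_scalar[OF A v u] sym by simp

text \<open>The sum is indexed by \<open>j\<close> rather than by the vectors \<open>f j\<close>, so that \<open>f\<close> need not be
  injective: iterates \<open>A\<^sup>k b\<close> may well repeat.\<close>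

lemma weighted_sum_in_span:
  fixes c :: "nat \<Rightarrow> real" and f :: "nat \<Rightarrow> real vec"
  assumes f: "\<And>j. f j \<in> carrier_vec n"
  shows "m \<le> N \<Longrightarrow> vec n (\<lambda>i. \<Sum>j<m. c j * f j $ i)
    \<in> LinearCombinations.module.span class_ring (module_vec TYPE(real) n) {f k |k. k < N}"
proof (induction m)
  interpret vec_space "TYPE(real)" n .
  let ?S = "{f k |k. k < N}"
  have S: "?S \<subseteq> carrier_vec n" using f by auto
  {
    case 0
    have "0\<^sub>v n \<in> span ?S" using span_zero by simp
    then show ?case by (simp add: zero_vec_def)
  next
    case (Suc m)
    have "f m \<in> span ?S" using Suc.prems S by (intro span_mem) auto
    then have "c m \<cdot>\<^sub>v f m \<in> span ?S" by (rule smult_in_span[OF S])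
    with Suc have "vec n (\<lambda>i. \<Sum>j<m. c j * f j $ i) + c m \<cdot>\<^sub>v f m \<in> span ?S"
      by (intro span_add1[OF S]) auto
    also have "vec n (\<lambda>i. \<Sum>j<m. c j * f j $ i) + c m \<cdot>\<^sub>v f m
        = vec n (\<lambda>i. \<Sum>j<Suc m. c j * f j $ i)"
      using f[of m] by (intro eq_vecI) auto
    finally show ?case .
  }
qed

lemma span_orthogonal:
  fixes w :: "real vec"
  assumes S: "S \<subseteq> carrier_vec n" and w: "w \<in> carrier_vec n" and orth: "\<And>v. v \<in> S \<Longrightarrow> w \<bullet> v = 0"
    and v: "v \<in> LinearCombinations.module.span class_ring (module_vec TYPE(real) n) S"
  shows "w \<bullet> v = 0"
proof -
  interpret vec_space "TYPE(real)" n .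
  let ?N = "{v \<in> carrier_vec n. w \<bullet> v = 0}"
  have "submodule class_ring ?N V"
    using w by unfold_locales (auto simp: scalar_prod_add_distrib[of _ n])
  then have "span S \<subseteq> ?N" using S orth by (intro span_is_subset) auto
  then show ?thesis using v by auto
qed

text \<open>Uncontrollability speaks only of the powers below \<open>n\<close>, but the orthogonal vector can be found
  for all powers at once.  The square matrix \<open>K\<close> of the iterates \<open>A\<^sup>k b\<close>, \<open>k < n\<close>, is singular, so
  there are \<open>w \<noteq> 0\<close> orthogonal to its columns and a linear dependency \<open>c \<noteq> 0\<close> among them.  If \<open>m\<close> is
  the largest index with \<open>c\<^sub>m \<noteq> 0\<close>, the dependency expresses \<open>A\<^sup>m b\<close> by earlier iterates; applying
  powers of \<open>A\<close> expresses every later iterate in the same way.  This replaces the Cayley--Hamilton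
  theorem.\<close>

lemma uncontrollable_iff_orthogonal:
  assumes A: "A \<in> carrier_mat n n" and b: "b \<in> carrier_vec n"
  shows "\<not> controllable n A b \<longleftrightarrow>
    (\<exists>w \<in> carrier_vec n. w \<noteq> 0\<^sub>v n \<and> (\<forall>k. w \<bullet> (A ^\<^sub>m k *\<^sub>v b) = 0))"
proof
  let ?f = "\<lambda>k. A ^\<^sub>m k *\<^sub>v b"
  let ?K = "mat n n (\<lambda>(i, k). ?f k $ i)"
  have f: "?f k \<in> carrier_vec n" for k by (rule mult_mat_vec_carrier[OF pow_carrier_mat[OF A] b])
  have K: "?K \<in> carrier_mat n n" by simp
  show "\<not> controllable n A b"
    if ex: "\<exists>w \<in> carrier_vec n. w \<noteq> 0\<^sub>v n \<and> (\<forall>k. w \<bullet> ?f k = 0)"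
  proof
    assume c: "controllable n A b"
    obtain w where w: "w \<in> carrier_vec n" "w \<noteq> 0\<^sub>v n" and o: "\<And>k. w \<bullet> ?f k = 0"
      using ex by auto
    have S: "{?f k |k. k < n} \<subseteq> carrier_vec n" using f by blast
    have orth: "w \<bullet> v = 0" if "v \<in> {?f k |k. k < n}" for v using that o by blast
    have "w \<in> LinearCombinations.module.span class_ring (module_vec TYPE(real) n) {?f k |k. k < n}"
      using c w(1) unfolding controllable_def by (rule ssubst)
    with S w(1) orth have "w \<bullet> w = 0" by (rule span_orthogonal)
    then have "(\<Sum>i = 0..<n. w $ i * w $ i) = 0" using w by (simp add: scalar_prod_def)
    then have "\<forall>i\<in>{0..<n}. w $ i * w $ i = 0" by (subst (asm) sum_nonneg_eq_0_iff) auto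
    then show False using w by auto
  qed
  assume nc: "\<not> controllable n A b"
  have mult: "?K *\<^sub>v y = vec n (\<lambda>i. \<Sum>j<n. y $ j * ?f j $ i)" if "y \<in> carrier_vec n" for y
    using that by (intro eq_vecI) (auto simp: scalar_prod_def atLeast0LessThan intro!: sum.cong)
  have det: "det ?K = 0"
  proof (rule ccontr)
    assume "det ?K \<noteq> 0"
    then have "?K \<in> Units (ring_mat TYPE(real) n ())" by (intro det_non_zero_imp_unit K)
    then obtain B where B: "B \<in> carrier_mat n n" and KB: "?K * B = 1\<^sub>m n"
      by (auto simp: Units_def ring_mat_def)
    have "carrier_vec n \<subseteq>
      LinearCombinations.module.span class_ring (module_vec TYPE(real) n) {?f k |k. k < n}"
    proof
      fix v :: "real vec" assume v: "v \<in> carrier_vec n"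
      have Bv: "B *\<^sub>v v \<in> carrier_vec n" using B v by simp
      have "v = ?K *\<^sub>v (B *\<^sub>v v)" using assoc_mult_mat_vec[OF K B v] KB v by simp
      also have "\<dots> = vec n (\<lambda>i. \<Sum>j<n. (B *\<^sub>v v) $ j * ?f j $ i)" by (rule mult[OF Bv])
      finally show "v \<in> LinearCombinations.module.span class_ring
          (module_vec TYPE(real) n) {?f k |k. k < n}"
        using weighted_sum_in_span[of ?f n n n "\<lambda>j. (B *\<^sub>v v) $ j", OF f order_refl] by simp
    qed
    moreover have "LinearCombinations.module.span class_ring
        (module_vec TYPE(real) n) {?f k |k. k < n} \<subseteq> carrier_vec n"
    proof -
      interpret vec_space "TYPE(real)" n .
      show ?thesis using f by (intro span_is_subset2) auto
    qed
    ultimately show False using nc by (auto simp: controllable_def)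
  qed
  then have "det (transpose_mat ?K) = 0" using det_transpose[OF K] by simp
  then obtain w where w: "w \<in> carrier_vec n" "w \<noteq> 0\<^sub>v n" and Kw: "transpose_mat ?K *\<^sub>v w = 0\<^sub>v n"
    using det_0_iff_vec_prod_zero_field[OF transpose_carrier_mat[THEN iffD2, OF K]] by auto
  obtain c where c: "c \<in> carrier_vec n" "c \<noteq> 0\<^sub>v n" and Kc: "?K *\<^sub>v c = 0\<^sub>v n"
    using det det_0_iff_vec_prod_zero_field[OF K] by auto
  have start: "w \<bullet> ?f k = 0" if "k < n" for k
  proof -
    have "(transpose_mat ?K *\<^sub>v w) $ k = col ?K k \<bullet> w" using that by simp
    also have "col ?K k = ?f k" using that A by (intro eq_vecI) auto
    also have "?f k \<bullet> w = w \<bullet> ?f k" by (rule comm_scalar_prod[OF f w(1)])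
    finally show ?thesis using Kw that by simp
  qed
  define m where "m = Max {j. j < n \<and> c $ j \<noteq> 0}"
  have ne: "{j. j < n \<and> c $ j \<noteq> 0} \<noteq> {}" using c by (auto simp: vec_eq_iff)
  have m: "m < n" "c $ m \<noteq> 0" using Max_in[OF _ ne] by (auto simp: m_def)
  have above: "c $ j = 0" if "m < j" "j < n" for j
    using Max_ge[of "{j. j < n \<and> c $ j \<noteq> 0}" j] that by (fastforce simp: m_def)
  have rel: "(\<Sum>j<Suc m. c $ j * ?f j $ i) = 0" if "i < n" for i
  proof -
    have "(\<Sum>j<Suc m. c $ j * ?f j $ i) = (\<Sum>j<n. c $ j * ?f j $ i)"
      using m above by (intro sum.mono_neutral_left) auto
    also have "\<dots> = (?K *\<^sub>v c) $ i" using that by (simp add: mult[OF c(1)])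
    finally show ?thesis using Kc that by simp
  qed
  \<comment> \<open>the linear relation multiplied by \<open>A\<^sup>l\<close>\<close>
  have pow: "(\<Sum>j<Suc m. c $ j * ?f (l + j) $ i) = 0" if "i < n" for l i
    using that
  proof (induction l arbitrary: i)
    case 0
    then show ?case using rel by simp
  next
    case (Suc l)
    have "?f (Suc l + j) $ i = (\<Sum>k<n. A $$ (i, k) * ?f (l + j) $ k)" for j
    proof -
      have "?f (Suc l + j) = A *\<^sub>v ?f (l + j)" using pow_mat_Suc_mult_vec[OF A b, of "l + j"] by simp
      then show ?thesis using Suc.prems A f[of "l + j"]
        by (simp add: scalar_prod_def atLeast0LessThan)
    qed
    then have "(\<Sum>j<Suc m. c $ j * ?f (Suc l + j) $ i)
        = (\<Sum>j<Suc m. \<Sum>k<n. A $$ (i, k) * (c $ j * ?f (l + j) $ k))"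
      by (simp add: sum_distrib_left mult.left_commute)
    also have "\<dots> = (\<Sum>k<n. \<Sum>j<Suc m. A $$ (i, k) * (c $ j * ?f (l + j) $ k))" by (rule sum.swap)
    also have "\<dots> = (\<Sum>k<n. A $$ (i, k) * (\<Sum>j<Suc m. c $ j * ?f (l + j) $ k))"
      by (simp only: sum_distrib_left)
    also have "\<dots> = 0" using Suc.IH by simp
    finally show ?case .
  qed
  have "w \<bullet> ?f k = 0" for k
  proof (induction k rule: less_induct)
    case (less k)
    show ?case
    proof (cases "k < n")
      case True
      then show ?thesis by (rule start)
    next
      case False
      define l where "l = k - m"
      have k: "k = l + m" using False m by (simp add: l_def)
      have "(\<Sum>j<Suc m. c $ j * (w \<bullet> ?f (l + j))) = (\<Sum>j<Suc m. \<Sum>i<n. w $ i * (c $ j * ?f (l + j) $ i))"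
      proof (rule sum.cong[OF refl])
        fix j
        show "c $ j * (w \<bullet> ?f (l + j)) = (\<Sum>i<n. w $ i * (c $ j * ?f (l + j) $ i))"
          using A b by (simp add: scalar_prod_def atLeast0LessThan sum_distrib_left mult.left_commute)
      qed
      also have "\<dots> = (\<Sum>i<n. \<Sum>j<Suc m. w $ i * (c $ j * ?f (l + j) $ i))" by (rule sum.swap)
      also have "\<dots> = (\<Sum>i<n. w $ i * (\<Sum>j<Suc m. c $ j * ?f (l + j) $ i))"
        by (simp only: sum_distrib_left)
      also have "\<dots> = 0" using pow by simp
      finally have "(\<Sum>j<m. c $ j * (w \<bullet> ?f (l + j))) + c $ m * (w \<bullet> ?f k) = 0" by (simp add: k)
      moreover have "(\<Sum>j<m. c $ j * (w \<bullet> ?f (l + j))) = 0"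
        using less.IH by (intro sum.neutral) (auto simp: k)
      ultimately show ?thesis using m by simp
    qed
  qed
  then show "\<exists>w \<in> carrier_vec n. w \<noteq> 0\<^sub>v n \<and> (\<forall>k. w \<bullet> ?f k = 0)" using w by blast
qed

section \<open>The Laplacian as a quadratic form\<close>

lemma adjacency_mat_index:
  assumes "i < n" "j < n"
  shows "adjacency_mat n G $$ (i, j) = (if (Suc i, Suc j) \<in> parcs G then 1 else 0)"
  using assms by (simp add: adjacency_mat_def)

lemma laplacian_mat_dim [simp]:
  "dim_row (laplacian_mat n G) = n" "dim_col (laplacian_mat n G) = n"
  by (simp_all add: laplacian_mat_def adjacency_mat_def)

lemma laplacian_mat_carrier [simp]: "laplacian_mat n G \<in> carrier_mat n n"
  by (simp add: carrier_matI)

lemma graph_on_sym: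
  assumes "graph_on n G"
  shows "(u, v) \<in> parcs G \<longleftrightarrow> (v, u) \<in> parcs G"
proof -
  interpret pair_graph G using assms by (simp add: graph_on_def)
  show ?thesis using pair_sym_arcs unfolding symmetric_def by (auto simp: sym_def)
qed

lemma graph_on_arcs:
  assumes "graph_on n G" "(u, v) \<in> parcs G"
  shows "u \<in> {1..n}" "v \<in> {1..n}" "u \<noteq> v"
proof -
  interpret pair_graph G using assms by (simp add: graph_on_def)
  show "u \<in> {1..n}" "v \<in> {1..n}" "u \<noteq> v"
    using assms in_arcsD1 in_arcsD2 pair_no_loops[of "(u, v)"] by (auto simp: graph_on_def)
qed

lemma adjacency_mat_sym:
  assumes "graph_on n G" "i < n" "j < n"
  shows "adjacency_mat n G $$ (i, j) = adjacency_mat n G $$ (j, i)"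
  using assms(2,3) graph_on_sym[OF assms(1), of "Suc i"] by (simp add: adjacency_mat_index)

lemma out_degree_adjacency:
  assumes G: "graph_on n G" and i: "i < n"
  shows "real (out_degree (with_proj G) (Suc i)) = (\<Sum>j<n. adjacency_mat n G $$ (i, j))"
proof -
  let ?J = "{j. j < n \<and> (Suc i, Suc j) \<in> parcs G}"
  have "out_arcs (with_proj G) (Suc i) = (\<lambda>j. (Suc i, Suc j)) ` ?J"
  proof (intro equalityI subsetI)
    fix e assume "e \<in> out_arcs (with_proj G) (Suc i)"
    then obtain v where e: "e = (Suc i, v)" "(Suc i, v) \<in> parcs G"
      by (cases e) (auto simp: out_arcs_def)
    then obtain j where "v = Suc j" "j < n" using graph_on_arcs(2)[OF G e(2)] by (cases v) auto
    then show "e \<in> (\<lambda>j. (Suc i, Suc j)) ` ?J" using e by auto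
  qed (auto simp: out_arcs_def)
  then have "out_degree (with_proj G) (Suc i) = card ?J"
    by (simp add: out_degree_def card_image inj_on_def)
  also have "real (card ?J) = (\<Sum>j<n. if (Suc i, Suc j) \<in> parcs G then 1 else 0)"
    by (simp add: sum.If_cases Int_def)
  also have "\<dots> = (\<Sum>j<n. adjacency_mat n G $$ (i, j))"
    using i by (intro sum.cong) (auto simp: adjacency_mat_index)
  finally show ?thesis .
qed

lemma laplacian_mat_index:
  assumes "graph_on n G" "i < n" "j < n"
  shows "laplacian_mat n G $$ (i, j) =
    (if i = j then \<Sum>k<n. adjacency_mat n G $$ (i, k) else 0) - adjacency_mat n G $$ (i, j)"
proof -
  have "adjacency_mat n G \<in> carrier_mat n n" by (simp add: adjacency_mat_def)
  then show ?thesis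
    using assms by (simp add: laplacian_mat_def degree_mat_def out_degree_adjacency)
qed

lemma transpose_laplacian_mat:
  assumes "graph_on n G"
  shows "transpose_mat (laplacian_mat n G) = laplacian_mat n G"
  using adjacency_mat_sym[OF assms]
  by (intro eq_matI) (auto simp: laplacian_mat_index[OF assms])

lemma laplacian_column_sum:
  assumes G: "graph_on n G" and j: "j < n"
  shows "(\<Sum>i<n. laplacian_mat n G $$ (i, j)) = 0"
proof -
  have "(\<Sum>i<n. laplacian_mat n G $$ (i, j)) =
      (\<Sum>i<n. (if i = j then \<Sum>k<n. adjacency_mat n G $$ (j, k) else 0) - adjacency_mat n G $$ (j, i))"
    using j adjacency_mat_sym[OF G _ j] by (intro sum.cong) (auto simp: laplacian_mat_index[OF G])
  also have "\<dots> = 0" using j by (simp add: sum_subtractf)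
  finally show ?thesis .
qed

lemma laplacian_mult_vec_index:
  fixes x :: "'a :: real_field vec"
  assumes G: "graph_on n G" and x: "x \<in> carrier_vec n" and i: "i < n"
  shows "(map_mat of_real (laplacian_mat n G) *\<^sub>v x) $ i =
    (\<Sum>j<n. of_real (adjacency_mat n G $$ (i, j)) * (x $ i - x $ j))"
proof -
  have "(map_mat of_real (laplacian_mat n G) *\<^sub>v x) $ i
      = (\<Sum>j<n. of_real (laplacian_mat n G $$ (i, j)) * x $ j)"
    using i x by (simp add: scalar_prod_def atLeast0LessThan)
  also have "\<dots> = (\<Sum>j<n. (if i = j then of_real (\<Sum>k<n. adjacency_mat n G $$ (i, k)) * x $ i else 0)
      - of_real (adjacency_mat n G $$ (i, j)) * x $ j)"
    using i by (intro sum.cong) (auto simp: laplacian_mat_index[OF G] algebra_simps)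
  also have "\<dots> = of_real (\<Sum>k<n. adjacency_mat n G $$ (i, k)) * x $ i
      - (\<Sum>j<n. of_real (adjacency_mat n G $$ (i, j)) * x $ j)"
    using i by (simp add: sum_subtractf)
  also have "\<dots> = (\<Sum>j<n. of_real (adjacency_mat n G $$ (i, j)) * (x $ i - x $ j))"
    by (simp add: sum_distrib_right right_diff_distrib sum_subtractf)
  finally show ?thesis .
qed

text \<open>The sum \<open>x\<^sup>* L x\<close> for the Laplacian of a weighted graph, symmetrised by exchanging \<open>i\<close> and
  \<open>j\<close>.  Complex \<open>x\<close> and general symmetric weights are allowed because the identity is applied to complex
  eigenvectors, and both to \<open>G\<close> and to the complete graph.\<close>

lemma hermitian_sum_eq_quadratic_form:
  fixes w :: "nat \<Rightarrow> nat \<Rightarrow> real" and x :: "nat \<Rightarrow> complex"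
  assumes sym: "\<And>i j. i < n \<Longrightarrow> j < n \<Longrightarrow> w i j = w j i"
  shows "2 * (\<Sum>i<n. cnj (x i) * (\<Sum>j<n. of_real (w i j) * (x i - x j)))
    = of_real (\<Sum>i<n. \<Sum>j<n. w i j * (cmod (x i - x j))\<^sup>2)"
proof -
  let ?S = "\<Sum>i<n. \<Sum>j<n. of_real (w i j) * (cnj (x i) * (x i - x j))"
  have "?S = (\<Sum>j<n. \<Sum>i<n. of_real (w i j) * (cnj (x i) * (x i - x j)))" by (rule sum.swap)
  also have "\<dots> = (\<Sum>i<n. \<Sum>j<n. of_real (w i j) * (cnj (x j) * (x j - x i)))"
    using sym by (intro sum.cong) auto
  finally have "?S + ?S = ?S + (\<Sum>i<n. \<Sum>j<n. of_real (w i j) * (cnj (x j) * (x j - x i)))"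
    by (rule arg_cong)
  also have "\<dots> = (\<Sum>i<n. \<Sum>j<n. of_real (w i j * (cmod (x i - x j))\<^sup>2))"
    by (simp only: sum.distrib [symmetric] of_real_mult complex_norm_square)
      (simp add: algebra_simps)
  finally show ?thesis by (simp add: sum_distrib_left mult_ac)
qed

text \<open>For an eigenvector \<open>x\<close> the quadratic form \<open>x\<^sup>* L x\<close> is real and nonnegative.  It is at most the
  form of the complete graph, which is \<open>n \<bar>x\<bar>\<^sup>2 - \<bar>\<Sum>x\<^sub>i\<bar>\<^sup>2\<close>, hence at most \<open>n \<bar>x\<bar>\<^sup>2\<close>.\<close>

lemma laplacian_eigenvalue_bounds:
  assumes G: "graph_on n G" and ev: "eigenvalue (complex_mat (laplacian_mat n G)) k"
  obtains r where "k = of_real r" "0 \<le> r" "r \<le> real n"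
proof -
  let ?L = "complex_mat (laplacian_mat n G)"
  let ?a = "\<lambda>i j. adjacency_mat n G $$ (i, j)"
  have "dim_row ?L = n" by simp
  then obtain x where x: "x \<in> carrier_vec n" "x \<noteq> 0\<^sub>v n" and Lx: "?L *\<^sub>v x = k \<cdot>\<^sub>v x"
    using ev by (auto simp: eigenvalue_def eigenvector_def)
  let ?N = "\<Sum>i<n. (cmod (x $ i))\<^sup>2"
  let ?Q = "\<Sum>i<n. \<Sum>j<n. ?a i j * (cmod (x $ i - x $ j))\<^sup>2"
  \<comment> \<open>the quadratic form of the complete graph; the diagonal terms vanish whatever their weight\<close>
  let ?T = "\<Sum>i<n. \<Sum>j<n. 1 * (cmod (x $ i - x $ j))\<^sup>2"
  have N: "?N > 0"
  proof -
    obtain i where "i < n" "x $ i \<noteq> 0" using x by (auto simp: vec_eq_iff)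
    then show ?thesis by (intro sum_pos2[of _ i]) auto
  qed
  have a: "0 \<le> ?a i j" "?a i j \<le> 1" if "i < n" "j < n" for i j
    using that by (auto simp: adjacency_mat_index)
  have sq: "(complex_of_real (cmod z))\<^sup>2 = z * cnj z" for z
    using complex_norm_square[of z] by simp
  have "2 * (k * of_real ?N) = 2 * (\<Sum>i<n. cnj (x $ i) * (?L *\<^sub>v x) $ i)"
    using x unfolding Lx by (simp add: sum_distrib_left sq mult_ac)
  also have "\<dots> = 2 * (\<Sum>i<n. cnj (x $ i) * (\<Sum>j<n. of_real (?a i j) * (x $ i - x $ j)))"
    using laplacian_mult_vec_index[OF G x(1)] by simp
  also have "\<dots> = of_real ?Q"
    by (rule hermitian_sum_eq_quadratic_form) (rule adjacency_mat_sym[OF G])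
  finally have kN: "2 * (k * of_real ?N) = of_real ?Q" .
  have "of_real ?T = 2 * (\<Sum>i<n. cnj (x $ i) * (\<Sum>j<n. of_real 1 * (x $ i - x $ j)))"
    by (rule hermitian_sum_eq_quadratic_form[symmetric]) simp
  also have "\<dots> = 2 * (of_nat n * (\<Sum>i<n. x $ i * cnj (x $ i))
      - (\<Sum>i<n. x $ i) * cnj (\<Sum>i<n. x $ i))"
    by (simp add: sum_subtractf right_diff_distrib sum_distrib_left sum_distrib_right mult_ac)
  also have "\<dots> = of_real (2 * (real n * ?N - (cmod (\<Sum>i<n. x $ i))\<^sup>2))"
    by (simp add: sq)
  finally have "?T = 2 * (real n * ?N - (cmod (\<Sum>i<n. x $ i))\<^sup>2)"
    by (simp only: of_real_eq_iff)
  moreover have "?Q \<le> ?T" using a by (intro sum_mono mult_right_mono) auto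
  ultimately have le: "?Q \<le> 2 * (real n * ?N)" by (smt (verit) zero_le_power2)
  have ge: "0 \<le> ?Q" using a by (intro sum_nonneg mult_nonneg_nonneg) auto
  show thesis
  proof
    have "k * of_real (2 * ?N) = 2 * (k * of_real ?N)"
      by (simp only: of_real_mult of_real_numeral mult_ac)
    also note kN
    finally have "k * of_real (2 * ?N) = of_real ?Q" .
    moreover have "complex_of_real (2 * ?N) \<noteq> 0" using N unfolding of_real_eq_0_iff by simp
    ultimately show "k = of_real (?Q / (2 * ?N))"
      unfolding of_real_divide by (rule eq_divide_imp[rotated])
    show "0 \<le> ?Q / (2 * ?N)" using ge N by simp
    show "?Q / (2 * ?N) \<le> real n" using le N by (simp add: divide_le_eq mult_ac)
  qed
qed

lemma spectral_radius_laplacian_less_iff: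
  assumes G: "graph_on n G" and n: "n > 0"
  shows "spectral_radius (complex_mat (laplacian_mat n G)) < real n \<longleftrightarrow>
    \<not> eigenvalue (complex_mat (laplacian_mat n G)) (of_nat n)"
proof -
  let ?L = "complex_mat (laplacian_mat n G)"
  have L: "?L \<in> carrier_mat n n" by simp
  show ?thesis
  proof
    assume less: "spectral_radius ?L < real n"
    show "\<not> eigenvalue ?L (of_nat n)"
    proof
      assume "eigenvalue ?L (of_nat n)"
      then have "norm (of_nat n :: complex) \<in> norm ` spectrum ?L"
        unfolding spectrum_def by (intro imageI) simp
      from spectral_radius_mem_max(2)[OF L n this] less show False by simp
    qed
  next
    assume no: "\<not> eigenvalue ?L (of_nat n)"
    obtain k where k: "spectral_radius ?L = norm k" "eigenvalue ?L k"
      using spectral_radius_mem_max(1)[OF L n] by (auto simp: spectrum_def)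
    obtain r where r: "k = of_real r" "0 \<le> r" "r \<le> real n"
      using laplacian_eigenvalue_bounds[OF G k(2)] .
    have "r \<noteq> real n" using no k(2) r(1) by auto
    then show "spectral_radius ?L < real n" using k(1) r by simp
  qed
qed

text \<open>If \<open>L w = 0\<close> then the quadratic form vanishes at \<open>w\<close>, so every summand vanishes and \<open>w\<close> agrees
  at the two ends of each edge; connectedness spreads the value over the whole graph.\<close>

lemma laplacian_kernel_constant:
  assumes G: "graph_on n G" and conn: "Digraph_Component.connected (with_proj G)"
    and w: "w \<in> carrier_vec n" and Lw: "laplacian_mat n G *\<^sub>v w = 0\<^sub>v n"
    and i: "i < n" and j: "j < n"
  shows "w $ i = w $ j"
proof -
  interpret pair_graph G using G by (simp add: graph_on_def)
  have V: "pverts G = {1..n}" using G by (simp add: graph_on_def)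
  let ?L = "laplacian_mat n G"
  let ?a = "\<lambda>i j. adjacency_mat n G $$ (i, j)"
  let ?q = "\<lambda>i j. ?a i j * (cmod (of_real (w $ i) - of_real (w $ j)))\<^sup>2"
  have id: "map_mat of_real ?L = ?L" by (intro eq_matI) auto
  have "(\<Sum>j<n. ?a i j * (w $ i - w $ j)) = 0" if "i < n" for i
    using laplacian_mult_vec_index[OF G w that] that unfolding id Lw by simp
  then have "(\<Sum>j<n. complex_of_real (?a i j) * (of_real (w $ i) - of_real (w $ j))) = 0" if "i < n" for i
    using that by (simp flip: of_real_mult of_real_diff of_real_sum)
  then have "complex_of_real (\<Sum>i<n. \<Sum>j<n. ?q i j) = 0"
    by (subst hermitian_sum_eq_quadratic_form[symmetric]) (auto simp: adjacency_mat_sym[OF G])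
  then have sum0: "(\<Sum>i<n. \<Sum>j<n. ?q i j) = 0" by (simp only: of_real_eq_0_iff)
  have q: "0 \<le> ?q i j" if "i < n" "j < n" for i j using that by (simp add: adjacency_mat_index)
  have q0: "?q i j = 0" if ij: "i < n" "j < n" for i j
  proof -
    have "(\<Sum>j<n. ?q i j) = 0"
      using sum0 q ij by (subst (asm) sum_nonneg_eq_0_iff) (auto intro!: sum_nonneg)
    then show ?thesis using q ij by (subst (asm) sum_nonneg_eq_0_iff) auto
  qed
  have arc: "w $ (u - 1) = w $ (v - 1)" if uv: "(u, v) \<in> parcs G" for u v
  proof -
    obtain i j where "u = Suc i" "v = Suc j" "i < n" "j < n"
      using graph_on_arcs[OF G uv] by (cases u; cases v) auto
    then show ?thesis using q0[of i j] uv by (simp add: adjacency_mat_index flip: of_real_diff)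
  qed
  have "strongly_connected (with_proj G)"
    using conn pair_sym_arcs by (rule symmetric_connected_imp_strongly_connected[rotated])
  then have "Suc i \<rightarrow>\<^sup>*\<^bsub>with_proj G\<^esub> Suc j"
    using i j V by (auto simp: strongly_connected_def)
  then have "w $ (Suc i - 1) = w $ (Suc j - 1)"
  proof (induction rule: reachable_induct)
    case (step x y)
    then show ?case using arc[of x y] by simp
  qed simp
  then show ?thesis by simp
qed

text \<open>The eigenvector is \<open>n e\<^sub>v - (1, \<dots>, 1)\<close>.\<close>

lemma universal_vertex_eigenvalue:
  assumes G: "graph_on n G" and n: "n \<ge> 2" and v: "v < n"
    and univ: "\<And>u. u < n \<Longrightarrow> u \<noteq> v \<Longrightarrow> (Suc v, Suc u) \<in> parcs G"
  shows "eigenvalue (complex_mat (laplacian_mat n G)) (of_nat n)"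
proof -
  let ?L = "complex_mat (laplacian_mat n G)"
  let ?a = "\<lambda>i j. adjacency_mat n G $$ (i, j)"
  let ?x = "vec n (\<lambda>i. (if i = v then of_nat n else 0) - 1) :: complex vec"
  have dim: "dim_row ?L = n" by simp
  have av: "?a v u = (if u = v then 0 else 1)" if "u < n" for u
    using that v univ graph_on_arcs(3)[OF G, of "Suc v" "Suc v"] by (auto simp: adjacency_mat_index)
  have "?L *\<^sub>v ?x = of_nat n \<cdot>\<^sub>v ?x"
  proof (intro eq_vecI)
    fix i assume "i < dim_vec (of_nat n \<cdot>\<^sub>v ?x)"
    then have i: "i < n" by simp
    have "(?L *\<^sub>v ?x) $ i = (\<Sum>j<n. of_real (?a i j) * (?x $ i - ?x $ j))"
      by (rule laplacian_mult_vec_index[OF G _ i]) simp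
    also have "\<dots> = of_nat n * ?x $ i"
    proof (cases "i = v")
      case True
      have "(\<Sum>j<n. of_real (?a i j) * (?x $ i - ?x $ j)) = (\<Sum>j<n. of_nat n - (if j = v then of_nat n else 0))"
        using True i av by (intro sum.cong) auto
      also have "\<dots> = of_nat n * of_nat n - of_nat n" using v by (simp add: sum_subtractf)
      finally show ?thesis using True i by (simp add: algebra_simps)
    next
      case False
      have "(\<Sum>j<n. of_real (?a i j) * (?x $ i - ?x $ j)) = (\<Sum>j<n. if j = v then - of_nat n else 0)"
        using False i v av[OF i] adjacency_mat_sym[OF G i v] by (intro sum.cong) auto
      also have "\<dots> = - of_nat n" using v by simp
      finally show ?thesis using False i by simp
    qed
    finally show "(?L *\<^sub>v ?x) $ i = (of_nat n \<cdot>\<^sub>v ?x) $ i" using i by simp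
  qed simp
  moreover have "?x \<noteq> 0\<^sub>v n"
  proof
    assume "?x = 0\<^sub>v n"
    then have "?x $ v = 0" using v by simp
    then have "(of_nat n :: complex) = of_nat 1" using v by simp
    then show False using n by (simp only: of_nat_eq_iff)
  qed
  ultimately show ?thesis unfolding eigenvalue_def eigenvector_def dim by (intro exI[of _ ?x]) simp
qed

section \<open>The Laplacian of a cone\<close>

lemma cone_adjacency_mat_index:
  assumes G: "graph_on n G" and "i < n + 1" "j < n + 1"
  shows "adjacency_mat (n + 1) (cone n G) $$ (i, j) =
    (if i < n \<and> j < n then adjacency_mat n G $$ (i, j) else if i = j then 0 else 1)"
proof -
  have "pverts G = {1..n}" using G by (simp add: graph_on_def)
  then show ?thesis
    using assms graph_on_arcs(1,2)[OF G, of "Suc i" "Suc j"]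
    by (auto simp: adjacency_mat_index cone_def)
qed

lemma laplacian_cone:
  assumes G: "graph_on n G"
  shows "laplacian_mat (n + 1) (cone n G) =
    four_block_mat (laplacian_mat n G + 1\<^sub>m n) (mat n 1 (\<lambda>_. - 1))
      (mat 1 n (\<lambda>_. - 1)) (mat 1 1 (\<lambda>_. real n))"
    (is "?C = ?B")
proof (rule eq_matI)
  note C = graph_on_cone[OF G]
  let ?a = "\<lambda>i j. adjacency_mat (n + 1) (cone n G) $$ (i, j)"
  show "dim_row ?C = dim_row ?B" "dim_col ?C = dim_col ?B" by simp_all
  fix i j assume "i < dim_row ?B" "j < dim_col ?B"
  then have ij: "i < n + 1" "j < n + 1" by auto
  have inner: "(\<Sum>k<n + 1. ?a i k) = (\<Sum>k<n. adjacency_mat n G $$ (i, k)) + 1" if "i < n"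
  proof -
    have "(\<Sum>k<n. ?a i k) = (\<Sum>k<n. adjacency_mat n G $$ (i, k))"
      using that by (intro sum.cong) (auto simp: cone_adjacency_mat_index[OF G, simplified])
    moreover have "?a i n = 1" using that by (simp add: cone_adjacency_mat_index[OF G, simplified])
    ultimately show ?thesis by simp
  qed
  have apex: "(\<Sum>k<n + 1. ?a n k) = real n"
    by (simp add: cone_adjacency_mat_index[OF G, simplified])
  have "?C $$ (i, j) = (if i = j then \<Sum>k<n + 1. ?a i k else 0) - ?a i j"
    by (rule laplacian_mat_index[OF C ij])
  also have "\<dots> = ?B $$ (i, j)"
  proof (cases "i < n")
    case True
    have B: "?B $$ (i, j) = (if j < n then laplacian_mat n G $$ (i, j) + (if i = j then 1 else 0) else - 1)"
      using True ij by (subst index_mat_four_block) auto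
    show ?thesis
      unfolding B inner[OF True] using True ij
      by (auto simp: cone_adjacency_mat_index[OF G, simplified] laplacian_mat_index[OF G])
  next
    case False
    then have i: "i = n" using ij by simp
    have B: "?B $$ (i, j) = (if j < n then - 1 else real n)"
      using i ij by (subst index_mat_four_block) auto
    show ?thesis
      unfolding B i apex using ij
      by (auto simp: cone_adjacency_mat_index[OF G, simplified])
  qed
  finally show "?C $$ (i, j) = ?B $$ (i, j)" .
qed

text \<open>Subtracting the upper rows from \<open>y\<close> times the last row clears the last row except for its
  final entry \<open>y d - n\<close>, because the columns of \<open>A\<close> all sum to \<open>y\<close>; the row operation itself has
  determinant \<open>y\<close>.\<close>

lemma det_bordered_by_ones:
  fixes A :: "'a :: idom mat"
  assumes A: "A \<in> carrier_mat n n" and col: "\<And>j. j < n \<Longrightarrow> (\<Sum>i<n. A $$ (i, j)) = y"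
  shows "y * det (four_block_mat A (mat n 1 (\<lambda>_. 1)) (mat 1 n (\<lambda>_. 1)) (mat 1 1 (\<lambda>_. d)))
    = (y * d - of_nat n) * det A"
proof -
  let ?M = "four_block_mat A (mat n 1 (\<lambda>_. 1)) (mat 1 n (\<lambda>_. 1)) (mat 1 1 (\<lambda>_. d))"
  let ?E = "four_block_mat (1\<^sub>m n) (0\<^sub>m n 1) (mat 1 n (\<lambda>_. - 1)) (mat 1 1 (\<lambda>_. y))"
  let ?T = "four_block_mat A (mat n 1 (\<lambda>_. 1)) (0\<^sub>m 1 n) (mat 1 1 (\<lambda>_. y * d - of_nat n))"
  have M: "?M \<in> carrier_mat (n + 1) (n + 1)" and E: "?E \<in> carrier_mat (n + 1) (n + 1)"
    using A by (intro four_block_carrier_mat; simp)+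
  have "?E * ?M = four_block_mat (1\<^sub>m n * A + 0\<^sub>m n 1 * mat 1 n (\<lambda>_. 1))
      (1\<^sub>m n * mat n 1 (\<lambda>_. 1) + 0\<^sub>m n 1 * mat 1 1 (\<lambda>_. d))
      (mat 1 n (\<lambda>_. - 1) * A + mat 1 1 (\<lambda>_. y) * mat 1 n (\<lambda>_. 1))
      (mat 1 n (\<lambda>_. - 1) * mat n 1 (\<lambda>_. 1) + mat 1 1 (\<lambda>_. y) * mat 1 1 (\<lambda>_. d))"
    using A by (intro mult_four_block_mat[of _ n n _ 1 _ 1 _ _ n _ 1]) auto
  also have "\<dots> = ?T"
  proof (rule arg_cong4[where f = four_block_mat])
    show "1\<^sub>m n * A + 0\<^sub>m n 1 * mat 1 n (\<lambda>_. 1) = A" using A by simp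
    show "1\<^sub>m n * mat n 1 (\<lambda>_. 1) + 0\<^sub>m n 1 * mat 1 1 (\<lambda>_. d) = mat n 1 (\<lambda>_. 1 :: 'a)"
      by simp
    show "mat 1 n (\<lambda>_. - 1) * A + mat 1 1 (\<lambda>_. y) * mat 1 n (\<lambda>_. 1) = 0\<^sub>m 1 n"
      using A col by (intro eq_matI) (auto simp: scalar_prod_def atLeast0LessThan sum_negf)
    show "mat 1 n (\<lambda>_. - 1) * mat n 1 (\<lambda>_. 1) + mat 1 1 (\<lambda>_. y) * mat 1 1 (\<lambda>_. d)
        = mat 1 1 (\<lambda>_. y * d - of_nat n)"
      by (intro eq_matI) (auto simp: scalar_prod_def)
  qed
  finally have "det ?E * det ?M = det ?T" using det_mult[OF E M] by simp
  moreover have "det ?E = y"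
    by (subst det_four_block_mat_upper_right_zero[of _ n _ 1]) (auto simp: det_single)
  moreover have "det ?T = det A * (y * d - of_nat n)"
    using A by (subst det_four_block_mat_lower_left_zero[of _ n _ 1]) (auto simp: det_single)
  ultimately show ?thesis by (simp add: mult.commute)
qed

text \<open>At a point \<open>x\<close>, the matrix \<open>x I - L'\<close> is \<open>(x - 1) I - L\<close> bordered by ones with corner entry
  \<open>x - n\<close>.  The columns of \<open>L\<close> sum to \<open>0\<close>, so those of \<open>(x - 1) I - L\<close> sum to \<open>x - 1\<close>.\<close>

lemma char_poly_laplacian_cone:
  assumes G: "graph_on n G"
  shows "[:- 1, 1:] * char_poly (complex_mat (laplacian_mat (n + 1) (cone n G)))
    = [:0, 1:] * [:- of_nat (n + 1), 1:] * (char_poly (complex_mat (laplacian_mat n G)) \<circ>\<^sub>p [:- 1, 1:])"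
proof (rule poly_ext)
  fix x :: complex
  let ?L = "complex_mat (laplacian_mat n G)"
  let ?C = "complex_mat (laplacian_mat (n + 1) (cone n G))"
  let ?A = "- char_matrix ?L (x - 1)"
  have L: "?L \<in> carrier_mat n n" and C: "?C \<in> carrier_mat (n + 1) (n + 1)" by simp_all
  have A: "?A \<in> carrier_mat n n" using L by simp
  have Aij: "?A $$ (i, j) = (if i = j then x - 1 else 0) - of_real (laplacian_mat n G $$ (i, j))"
    if "i < n" "j < n" for i j
    using that by (auto simp: char_matrix_def)
  have col: "(\<Sum>i<n. ?A $$ (i, j)) = x - 1" if j: "j < n" for j
  proof -
    have "(\<Sum>i<n. ?A $$ (i, j)) = (\<Sum>i<n. (if i = j then x - 1 else 0) - of_real (laplacian_mat n G $$ (i, j)))"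
      using j Aij by (intro sum.cong) auto
    also have "\<dots> = x - 1 - of_real (\<Sum>i<n. laplacian_mat n G $$ (i, j))"
      using j by (simp add: sum_subtractf)
    finally show ?thesis by (simp add: laplacian_column_sum[OF G j])
  qed
  have block: "- char_matrix ?C x =
      four_block_mat ?A (mat n 1 (\<lambda>_. 1)) (mat 1 n (\<lambda>_. 1)) (mat 1 1 (\<lambda>_. x - of_nat n))"
    unfolding laplacian_cone[OF G] char_matrix_def
    by (intro eq_matI) auto
  have "(x - 1) * poly (char_poly ?C) x = ((x - 1) * (x - of_nat n) - of_nat n) * poly (char_poly ?L) (x - 1)"
    unfolding char_poly_matrix[OF C] char_poly_matrix[OF L] block
    by (rule det_bordered_by_ones[OF A col])
  also have "(x - 1) * (x - of_nat n) - of_nat n = x * (x - of_nat (n + 1))"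
    by (simp add: algebra_simps)
  finally show "poly ([:- 1, 1:] * char_poly ?C) x =
      poly ([:0, 1:] * [:- of_nat (n + 1), 1:] * (char_poly ?L \<circ>\<^sub>p [:- 1, 1:])) x"
    by (simp add: poly_pcompose algebra_simps)
qed

lemma order_pcompose_shift:
  fixes p :: "'a :: idom poly"
  assumes p: "p \<noteq> 0"
  shows "Polynomial.order k (p \<circ>\<^sub>p [:- c, 1:]) = Polynomial.order (k - c) p"
proof -
  obtain q where q: "p = [:- (k - c), 1:] ^ Polynomial.order (k - c) p * q" and nd: "\<not> [:- (k - c), 1:] dvd q"
    using order_decomp[OF p] by blast
  have "p \<circ>\<^sub>p [:- c, 1:] = [:- k, 1:] ^ Polynomial.order (k - c) p * (q \<circ>\<^sub>p [:- c, 1:])"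
    by (subst q) (simp add: pcompose_mult hom_distribs pcompose_pCons)
  moreover have "poly (q \<circ>\<^sub>p [:- c, 1:]) k \<noteq> 0"
    using nd by (simp add: poly_pcompose poly_eq_0_iff_dvd)
  moreover from this have "q \<circ>\<^sub>p [:- c, 1:] \<noteq> 0" by auto
  ultimately show ?thesis
    by (simp add: order_mult order_power_n_n order_0I)
qed

lemma simple_spectrum_iff_order_le:
  assumes A: "A \<in> carrier_mat n n"
  shows "simple_spectrum A \<longleftrightarrow> (\<forall>k. Polynomial.order k (char_poly (complex_mat A)) \<le> 1)"
proof -
  have C: "complex_mat A \<in> carrier_mat n n" using A by simp
  have "char_poly (complex_mat A) \<noteq> 0" using degree_monic_char_poly[OF C] by auto
  then have "eigenvalue (complex_mat A) k \<longleftrightarrow> Polynomial.order k (char_poly (complex_mat A)) \<noteq> 0" for k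
    by (simp add: eigenvalue_root_char_poly[OF C] order_root)
  then show ?thesis unfolding simple_spectrum_def by (metis le_numeral_extra(4) le_zero_eq One_nat_def le_SucE zero_le)
qed

text \<open>Comparing root orders in the identity for the characteristic polynomials: the factor
  \<open>x - (n + 1)\<close> adds \<open>1\<close> to the order of \<open>n\<close> in \<open>\<chi>\<^sub>L\<close>.  The factor \<open>x\<close> does no harm, because it is
  paired with the order of \<open>- 1\<close>, which is not an eigenvalue of a positive semidefinite matrix.\<close>

lemma simple_spectrum_cone_iff:
  assumes G: "graph_on n G" and n: "n > 0" and simple: "simple_spectrum (laplacian_mat n G)"
  shows "simple_spectrum (laplacian_mat (n + 1) (cone n G)) \<longleftrightarrow>
    \<not> eigenvalue (complex_mat (laplacian_mat n G)) (of_nat n)"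
proof -
  let ?L = "complex_mat (laplacian_mat n G)"
  let ?C = "complex_mat (laplacian_mat (n + 1) (cone n G))"
  let ?l = "\<lambda>k. Polynomial.order k (char_poly ?L)"
  let ?c = "\<lambda>k. Polynomial.order k (char_poly ?C)"
  have L: "?L \<in> carrier_mat n n" and C: "?C \<in> carrier_mat (n + 1) (n + 1)" by simp_all
  have nz: "char_poly ?L \<noteq> 0" "char_poly ?C \<noteq> 0"
    using degree_monic_char_poly[OF L] degree_monic_char_poly[OF C] by auto
  have lin: "Polynomial.order k [:- a, 1:] = (if k = a then 1 else 0)" for k a :: complex
    using order_power_n_n[of a 1] by (auto intro: order_0I)
  have lin0: "Polynomial.order k [:0, 1:] = (if k = 0 then 1 else 0)" for k :: complex
    using lin[of k 0] by simp
  have nz': "char_poly ?L \<circ>\<^sub>p [:- 1, 1:] \<noteq> 0" using nz by (simp add: pcompose_eq_0_iff)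
  have key: "(if k = 1 then 1 else 0) + ?c k
      = (if k = 0 then 1 else 0) + (if k = of_nat (n + 1) then 1 else 0) + ?l (k - 1)" for k
  proof -
    have "Polynomial.order k ([:- 1, 1:] * char_poly ?C) = (if k = 1 then 1 else 0) + ?c k"
      using nz by (subst order_mult) (auto simp: lin simp del: mult_pCons_left)
    moreover have "Polynomial.order k ([:0, 1:] * [:- of_nat (n + 1), 1:] * (char_poly ?L \<circ>\<^sub>p [:- 1, 1:]))
        = (if k = 0 then 1 else 0) + (if k = of_nat (n + 1) then 1 else 0) + ?l (k - 1)"
    proof -
      have "Polynomial.order k (p * q * r)
          = Polynomial.order k p + Polynomial.order k q + Polynomial.order k r"
        if "p \<noteq> 0" "q \<noteq> 0" "r \<noteq> 0" for p q r :: "complex poly"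
        using that by (simp add: order_mult)
      from this[OF _ _ nz', of "[:0, 1:]" "[:- of_nat (n + 1), 1:]"] show ?thesis
        unfolding lin lin0 order_pcompose_shift[OF nz(1)] by simp
    qed
    ultimately show ?thesis using char_poly_laplacian_cone[OF G] by metis
  qed
  have ev: "eigenvalue ?L k \<longleftrightarrow> ?l k \<noteq> 0" for k
    using nz by (simp add: eigenvalue_root_char_poly[OF L] order_root)
  have l1: "?l k \<le> 1" for k
    using simple simple_spectrum_iff_order_le[of "laplacian_mat n G" n] by simp
  have m1: "?l (- 1) = 0"
  proof (rule ccontr)
    assume "?l (- 1) \<noteq> 0"
    then obtain r where "- 1 = complex_of_real r" "0 \<le> r"
      using laplacian_eigenvalue_bounds[OF G] ev by metis
    then have "complex_of_real r = complex_of_real (- 1)" by simp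
    then have "r = - 1" by (simp only: of_real_eq_iff)
    then show False using \<open>0 \<le> r\<close> by simp
  qed
  have n1: "(of_nat (n + 1) :: complex) \<noteq> 1" "(of_nat (n + 1) :: complex) \<noteq> 0"
    using n by (simp_all del: of_nat_Suc of_nat_add flip: of_nat_1 add: of_nat_eq_iff)
  have "(\<forall>k. ?c k \<le> 1) \<longleftrightarrow> ?l (of_nat n) = 0"
  proof
    assume "\<forall>k. ?c k \<le> 1"
    then have "?c (of_nat (n + 1)) \<le> 1" by blast
    then show "?l (of_nat n) = 0" using key[of "of_nat (n + 1)"] n1 by simp
  next
    assume no: "?l (of_nat n) = 0"
    show "\<forall>k. ?c k \<le> 1"
    proof
      fix k :: complex
      consider "k = 0" | "k = of_nat (n + 1)" | "k \<noteq> 0" "k \<noteq> of_nat (n + 1)" by blast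
      then show "?c k \<le> 1"
      proof cases
        case 1
        then show ?thesis using key[of k] m1 n1 by simp
      next
        case 2
        then show ?thesis using key[of k] no n1 by simp
      next
        case 3
        then show ?thesis using key[of k] l1[of "k - 1"] by simp
      qed
    qed
  qed
  then show ?thesis using simple_spectrum_iff_order_le[of "laplacian_mat (n + 1) (cone n G)" "n + 1"] ev by simp
qed

section \<open>Connectedness, controllability and automorphisms of a cone\<close>

text \<open>Every vertex is joined to the apex.\<close>

lemma connected_cone:
  assumes G: "graph_on n G"
  shows "Digraph_Component.connected (with_proj (cone n G))"
proof -
  let ?V = "pverts (cone n G)" and ?R = "(parcs (cone n G))\<^sup>s"
  have arcs: "(u, n + 1) \<in> ?R" "(n + 1, u) \<in> ?R" if "u \<in> ?V" "u \<noteq> n + 1" for u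
    using that by (auto simp: cone_def symcl_def)
  have "n + 1 \<in> ?V" by (simp add: cone_def)
  then have refl: "(n + 1, n + 1) \<in> rtrancl_on ?V ?R" by (rule rtrancl_on_refl)
  have "(u, n + 1) \<in> rtrancl_on ?V ?R" "(n + 1, u) \<in> rtrancl_on ?V ?R" if u: "u \<in> ?V" for u
    using refl arcs[OF u] u \<open>n + 1 \<in> ?V\<close>
    by (cases "u = n + 1"; blast intro: rtrancl_on_refl rtrancl_on_into_rtrancl_on)+
  then show ?thesis
    unfolding connected_conv using \<open>n + 1 \<in> ?V\<close> by (auto intro: rtrancl_on_trans)
qed

text \<open>The one-vertex graph is controllable from the input \<open>1\<close>.\<close>

lemma strongly_uncontrollable_size:
  assumes su: "strongly_uncontrollable n G"
  shows "n \<ge> 2"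
proof (rule ccontr)
  assume "\<not> n \<ge> 2"
  moreover have "n \<noteq> 0"
    using su by (auto simp: strongly_uncontrollable_def graph_on_def connected_conv)
  ultimately have n: "n = 1" by simp
  let ?b = "vec 1 (\<lambda>_. 1) :: real vec"
  have b: "?b \<in> carrier_vec 1" by simp
  have "\<not> controllable 1 (laplacian_mat 1 G) ?b"
    using su n by (simp add: strongly_uncontrollable_def)
  then obtain w where w: "w \<in> carrier_vec 1" "w \<noteq> 0\<^sub>v 1"
    and orth: "w \<bullet> (laplacian_mat 1 G ^\<^sub>m 0 *\<^sub>v ?b) = 0"
    using uncontrollable_iff_orthogonal[OF laplacian_mat_carrier b] by blast
  have "w \<bullet> ?b = 0" using orth by simp
  then have "w $ 0 = 0" by (simp add: scalar_prod_def)
  then show False using w by (auto simp: vec_eq_iff)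
qed

lemma laplacian_mult_vec_sum:
  assumes G: "graph_on n G" and x: "x \<in> carrier_vec n"
  shows "(\<Sum>i<n. (laplacian_mat n G *\<^sub>v x) $ i) = 0"
proof -
  let ?L = "laplacian_mat n G"
  have "(\<Sum>i<n. (?L *\<^sub>v x) $ i) = (\<Sum>i<n. \<Sum>j<n. ?L $$ (i, j) * x $ j)"
    using x by (simp add: scalar_prod_def atLeast0LessThan)
  also have "\<dots> = (\<Sum>j<n. \<Sum>i<n. ?L $$ (i, j) * x $ j)" by (rule sum.swap)
  also have "\<dots> = (\<Sum>j<n. (\<Sum>i<n. ?L $$ (i, j)) * x $ j)" by (simp only: sum_distrib_right)
  also have "\<dots> = 0" by (simp add: laplacian_column_sum[OF G])
  finally show ?thesis .
qed

lemma laplacian_cone_mult_vec: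
  assumes G: "graph_on n G" and u: "u \<in> carrier_vec n" and sum: "(\<Sum>i<n. u $ i) = 0"
  shows "laplacian_mat (n + 1) (cone n G) *\<^sub>v (u @\<^sub>v 0\<^sub>v 1) = (laplacian_mat n G *\<^sub>v u + u) @\<^sub>v 0\<^sub>v 1"
proof -
  let ?L = "laplacian_mat n G"
  have "laplacian_mat (n + 1) (cone n G) *\<^sub>v (u @\<^sub>v 0\<^sub>v 1) =
      ((?L + 1\<^sub>m n) *\<^sub>v u + mat n 1 (\<lambda>_. - 1) *\<^sub>v 0\<^sub>v 1) @\<^sub>v
      (mat 1 n (\<lambda>_. - 1) *\<^sub>v u + mat 1 1 (\<lambda>_. real n) *\<^sub>v 0\<^sub>v 1)"
    unfolding laplacian_cone[OF G] using u by (intro four_block_mat_mult_vec) auto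
  also have "(?L + 1\<^sub>m n) *\<^sub>v u + mat n 1 (\<lambda>_. - 1) *\<^sub>v 0\<^sub>v 1 = ?L *\<^sub>v u + u"
  proof -
    have "(?L + 1\<^sub>m n) *\<^sub>v u = ?L *\<^sub>v u + u"
      using add_mult_distrib_mat_vec[OF laplacian_mat_carrier one_carrier_mat u] u by simp
    moreover have "mat n 1 (\<lambda>_. - 1 :: real) *\<^sub>v 0\<^sub>v 1 = 0\<^sub>v n"
      by (intro eq_vecI) (auto simp: scalar_prod_def)
    ultimately show ?thesis
      using right_zero_vec[OF add_carrier_vec[OF mult_mat_vec_carrier[OF laplacian_mat_carrier u] u]]
      by simp
  qed
  also have "mat 1 n (\<lambda>_. - 1) *\<^sub>v u + mat 1 1 (\<lambda>_. real n) *\<^sub>v 0\<^sub>v 1 = 0\<^sub>v 1"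
    using u sum by (intro eq_vecI) (auto simp: scalar_prod_def sum_negf atLeast0LessThan)
  finally show ?thesis .
qed

text \<open>Vectors \<open>u\<close> with entry sum \<open>0\<close> that are orthogonal to all \<open>L\<^sup>k b\<close> form an \<open>(L + I)\<close>-invariant
  space, so their extensions by \<open>0\<close> form an \<open>L'\<close>-invariant space orthogonal to the input \<open>b'\<close>,
  whatever its last entry is.  The vector \<open>L w\<close> provides a nonzero element.\<close>

lemma uncontrollable_cone:
  assumes su: "strongly_uncontrollable n G" and b': "b' \<in> carrier_vec (n + 1)"
    and bin: "\<And>i. i < n + 1 \<Longrightarrow> b' $ i \<in> {0, 1}"
  shows "\<not> controllable (n + 1) (laplacian_mat (n + 1) (cone n G)) b'"
proof -
  have G: "graph_on n G" and conn: "Digraph_Component.connected (with_proj G)"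
    and unc: "\<And>b. b \<in> carrier_vec n \<Longrightarrow> (\<forall>i < n. b $ i \<in> {0, 1}) \<Longrightarrow>
      \<not> controllable n (laplacian_mat n G) b"
    using su by (auto simp: strongly_uncontrollable_def)
  have n: "n \<ge> 2" by (rule strongly_uncontrollable_size[OF su])
  let ?L = "laplacian_mat n G" and ?C = "laplacian_mat (n + 1) (cone n G)"
  note L = laplacian_mat_carrier[of n G] and C = laplacian_mat_carrier[of "n + 1" "cone n G"]
  note selfadj = scalar_prod_symmetric_mat[OF L transpose_laplacian_mat[OF G]]
  define b where "b = vec n (($) b')"
  have b: "b \<in> carrier_vec n" by (simp add: b_def)
  have Lk: "?L ^\<^sub>m k *\<^sub>v b \<in> carrier_vec n" for k
    by (rule mult_mat_vec_carrier[OF pow_carrier_mat[OF L] b])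
  have "\<not> controllable n ?L b" using bin by (intro unc b) (auto simp: b_def)
  then obtain w0 where w0: "w0 \<in> carrier_vec n" "w0 \<noteq> 0\<^sub>v n"
    and orth0: "\<And>k. w0 \<bullet> (?L ^\<^sub>m k *\<^sub>v b) = 0"
    using uncontrollable_iff_orthogonal[OF L b] by blast
  obtain w where w: "w \<in> carrier_vec n" and Lw: "?L *\<^sub>v w \<noteq> 0\<^sub>v n"
    and orth: "\<And>k. w \<bullet> (?L ^\<^sub>m k *\<^sub>v b) = 0"
  proof (cases "?L *\<^sub>v w0 = 0\<^sub>v n")
    case False
    then show thesis using that w0 orth0 by blast
  next
    case True
    note const = laplacian_kernel_constant[OF G conn]
    have w0c: "w0 $ i = w0 $ 0" if "i < n" for i using const[OF w0(1) True that] n by simp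
    \<comment> \<open>\<open>w0\<close> is constant, so orthogonality to \<open>b\<close> forces the zero input, to which every vector is orthogonal\<close>
    have "w0 $ 0 \<noteq> 0"
    proof
      assume "w0 $ 0 = 0"
      then have "w0 $ i = 0" if "i < n" for i using w0c[OF that] by (rule trans[rotated])
      then have "w0 = 0\<^sub>v n" using w0(1) by (intro eq_vecI) auto
      then show False using w0(2) by blast
    qed
    moreover have "w0 \<bullet> b = (\<Sum>i<n. w0 $ 0 * b $ i)"
      unfolding scalar_prod_def atLeast0LessThan
    proof (rule sum.cong)
      show "{..<dim_vec b} = {..<n}" using b by simp
      show "w0 $ i * b $ i = w0 $ 0 * b $ i" if "i \<in> {..<n}" for i using w0c[of i] that by simp
    qed
    then have "w0 \<bullet> b = w0 $ 0 * (\<Sum>i<n. b $ i)" by (simp only: sum_distrib_left)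
    moreover have "w0 \<bullet> b = 0" using orth0[of 0] b by simp
    ultimately have sum: "(\<Sum>i<n. b $ i) = 0" by simp
    have "b $ i \<ge> 0" if "i < n" for i using that bin[of i] by (auto simp: b_def)
    then have "\<forall>i\<in>{..<n}. b $ i = 0" using sum by (subst (asm) sum_nonneg_eq_0_iff) auto
    then have "b = 0\<^sub>v n" using b by (intro eq_vecI) auto
    then have "?L ^\<^sub>m k *\<^sub>v b = 0\<^sub>v n" for k
      by (intro eq_vecI) (auto simp: scalar_prod_def)
    then have "unit_vec n 0 \<bullet> (?L ^\<^sub>m k *\<^sub>v b) = 0" for k by simp
    moreover have "?L *\<^sub>v unit_vec n 0 \<noteq> 0\<^sub>v n"
      using const[of "unit_vec n 0" 0 1] n by auto
    ultimately show thesis using that[of "unit_vec n 0"] by simp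
  qed
  \<comment> \<open>the invariant space of vectors whose extensions by \<open>0\<close> are orthogonal to all \<open>?C\<^sup>k b'\<close>\<close>
  define P where "P u \<longleftrightarrow> u \<in> carrier_vec n \<and> (\<Sum>i<n. u $ i) = 0 \<and>
    (\<forall>k. u \<bullet> (?L ^\<^sub>m k *\<^sub>v b) = 0)" for u
  have shift: "(?L *\<^sub>v u) \<bullet> (?L ^\<^sub>m k *\<^sub>v b) = u \<bullet> (?L ^\<^sub>m Suc k *\<^sub>v b)"
    if "u \<in> carrier_vec n" for u k
    using selfadj[OF that Lk] pow_mat_Suc_mult_vec[OF L b] by metis
  have P_start: "P (?L *\<^sub>v w)"
    unfolding P_def
    using mult_mat_vec_carrier[OF L w] laplacian_mult_vec_sum[OF G w] shift[OF w] orth by metis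
  have P_step: "P (?L *\<^sub>v u + u)" if "P u" for u
  proof -
    have u: "u \<in> carrier_vec n" "(\<Sum>i<n. u $ i) = 0" and uo: "\<And>k. u \<bullet> (?L ^\<^sub>m k *\<^sub>v b) = 0"
      using that by (auto simp: P_def)
    have Lu: "?L *\<^sub>v u \<in> carrier_vec n" by (rule mult_mat_vec_carrier[OF L u(1)])
    have "(?L *\<^sub>v u + u) \<bullet> (?L ^\<^sub>m k *\<^sub>v b) = 0" for k
      using add_scalar_prod_distrib[OF Lu u(1) Lk] shift[OF u(1)] uo
      by (simp del: pow_mat.simps)
    moreover have "(\<Sum>i<n. (?L *\<^sub>v u + u) $ i) = (\<Sum>i<n. (?L *\<^sub>v u) $ i + u $ i)"
      using u(1) by (intro sum.cong) auto
    then have "(\<Sum>i<n. (?L *\<^sub>v u + u) $ i) = 0"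
      using laplacian_mult_vec_sum[OF G u(1)] u(2) by (simp only: sum.distrib)
    ultimately show ?thesis using Lu u(1) unfolding P_def by simp
  qed
  have ext: "u @\<^sub>v 0\<^sub>v 1 \<in> carrier_vec (n + 1)" if "P u" for u
    using that unfolding P_def by (intro append_carrier_vec) auto
  have "P u \<Longrightarrow> (u @\<^sub>v 0\<^sub>v 1) \<bullet> (?C ^\<^sub>m k *\<^sub>v b') = 0" for k u
  proof (induction k arbitrary: u)
    case 0
    then have u: "dim_vec u = n" and ub: "u \<bullet> (?L ^\<^sub>m 0 *\<^sub>v b) = 0"
      unfolding P_def by (simp, blast)
    have "(u @\<^sub>v 0\<^sub>v 1) \<bullet> b' = (\<Sum>i<n. u $ i * b $ i)"
      using b' u by (simp add: scalar_prod_def atLeast0LessThan b_def)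
    also have "\<dots> = u \<bullet> b" using b by (simp add: scalar_prod_def atLeast0LessThan)
    also have "\<dots> = 0" using ub b by simp
    finally show ?case using b' by simp
  next
    case (Suc k)
    have u: "u \<in> carrier_vec n" "(\<Sum>i<n. u $ i) = 0" using Suc.prems by (auto simp: P_def)
    have Ck: "?C ^\<^sub>m k *\<^sub>v b' \<in> carrier_vec (n + 1)"
      by (rule mult_mat_vec_carrier[OF pow_carrier_mat[OF C] b'])
    have "(u @\<^sub>v 0\<^sub>v 1) \<bullet> (?C ^\<^sub>m Suc k *\<^sub>v b') = (?C *\<^sub>v (u @\<^sub>v 0\<^sub>v 1)) \<bullet> (?C ^\<^sub>m k *\<^sub>v b')"
      using scalar_prod_symmetric_mat[OF C transpose_laplacian_mat[OF graph_on_cone[OF G]]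
          ext[OF Suc.prems] Ck] pow_mat_Suc_mult_vec[OF C b'] by metis
    also have "\<dots> = 0"
      unfolding laplacian_cone_mult_vec[OF G u] by (rule Suc.IH[OF P_step[OF Suc.prems]])
    finally show ?case .
  qed
  then have "\<forall>k. (?L *\<^sub>v w @\<^sub>v 0\<^sub>v 1) \<bullet> (?C ^\<^sub>m k *\<^sub>v b') = 0" using P_start by blast
  moreover have "?L *\<^sub>v w @\<^sub>v 0\<^sub>v 1 \<noteq> 0\<^sub>v (n + 1)"
  proof
    assume eq: "?L *\<^sub>v w @\<^sub>v 0\<^sub>v 1 = 0\<^sub>v (n + 1)"
    have "(?L *\<^sub>v w) $ i = 0" if "i < n" for i
      using arg_cong[OF eq, of "\<lambda>v. v $ i"] that by simp
    then have "?L *\<^sub>v w = 0\<^sub>v n" by (intro eq_vecI) auto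
    then show False using Lw by blast
  qed
  ultimately show ?thesis
    using uncontrollable_iff_orthogonal[OF C b'] ext[OF P_start] by blast
qed

lemma Aut_subset_Aut_cone:
  assumes G: "graph_on n G"
  shows "Aut G \<subseteq> Aut (cone n G)"
proof
  fix p assume p: "p \<in> Aut G"
  have V: "pverts G = {1..n}" using G by (simp add: graph_on_def)
  have perm: "p permutes {1..n}" using p V by (simp add: Aut_def)
  have fix_apex: "p (Suc n) = Suc n" using permutes_not_in[OF perm] by simp
  have pin: "p u \<in> {1..n} \<longleftrightarrow> u \<in> {1..n}" for u by (rule permutes_in_image[OF perm])
  have no: "(u, Suc n) \<notin> parcs G" "(Suc n, u) \<notin> parcs G" for u
    using graph_on_arcs(1,2)[OF G, of u "Suc n"] graph_on_arcs(1,2)[OF G, of "Suc n" u] by auto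
  have "(u, v) \<in> parcs (cone n G) \<longleftrightarrow> (p u, p v) \<in> parcs (cone n G)"
    if "u \<in> pverts (cone n G)" "v \<in> pverts (cone n G)" for u v
  proof -
    have "(u, v) \<in> parcs G \<longleftrightarrow> (p u, p v) \<in> parcs G" if "u \<in> {1..n}" "v \<in> {1..n}"
      using p that V unfolding Aut_def by blast
    moreover have "u \<in> {1..n} \<or> u = Suc n" "v \<in> {1..n} \<or> v = Suc n"
      using that V by (auto simp: cone_def)
    ultimately show ?thesis
      using pin[of u] pin[of v] fix_apex no by (auto simp: cone_def V)
  qed
  moreover have "p permutes pverts (cone n G)"
    using permutes_subset[OF perm] V by (auto simp: cone_def)
  ultimately show "p \<in> Aut (cone n G)" by (simp add: Aut_def)
qed

text \<open>If the apex is sent to a vertex \<open>v\<close> of \<open>G\<close>, then \<open>v\<close>, like the apex, is adjacent to all other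
  vertices of the cone.\<close>

lemma Aut_cone_subset_Aut:
  assumes G: "graph_on n G"
    and no_univ: "\<And>v. v \<in> {1..n} \<Longrightarrow> \<exists>u \<in> {1..n}. u \<noteq> v \<and> (v, u) \<notin> parcs G"
  shows "Aut (cone n G) \<subseteq> Aut G"
proof
  fix p assume p: "p \<in> Aut (cone n G)"
  have V: "pverts G = {1..n}" using G by (simp add: graph_on_def)
  have VC: "pverts (cone n G) = insert (Suc n) {1..n}" using V by (simp add: cone_def)
  have perm: "p permutes insert (Suc n) {1..n}" using p VC by (simp add: Aut_def)
  have arcs: "(u, v) \<in> parcs (cone n G) \<longleftrightarrow> (p u, p v) \<in> parcs (cone n G)"
    if "u \<in> insert (Suc n) {1..n}" "v \<in> insert (Suc n) {1..n}" for u v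
    using p that VC unfolding Aut_def by blast
  have cone_arcs: "(u, v) \<in> parcs (cone n G) \<longleftrightarrow> (u, v) \<in> parcs G"
    if "u \<in> {1..n}" "v \<in> {1..n}" for u v
    using that V by (auto simp: cone_def)
  have apex: "p (Suc n) = Suc n"
  proof (rule ccontr)
    assume neq: "p (Suc n) \<noteq> Suc n"
    define v where "v = p (Suc n)"
    have v: "v \<in> {1..n}"
      using permutes_in_image[OF perm, of "Suc n"] neq by (auto simp: v_def)
    obtain u where u: "u \<in> {1..n}" "u \<noteq> v" "(v, u) \<notin> parcs G" using no_univ[OF v] by blast
    have "u \<in> p ` insert (Suc n) {1..n}" using permutes_image[OF perm] u(1) by blast
    then obtain t where t: "t \<in> insert (Suc n) {1..n}" "u = p t" by blast
    have "t \<in> {1..n}" using t u(2) by (auto simp: v_def)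
    then have "(Suc n, t) \<in> parcs (cone n G)" using V by (simp add: cone_def)
    then have "(v, u) \<in> parcs (cone n G)" using arcs[of "Suc n" t] t by (simp add: v_def)
    then show False using cone_arcs[OF v u(1)] u(3) by blast
  qed
  have permV: "p permutes {1..n}"
    using perm by (rule permutes_superset) (use apex in auto)
  have "(u, v) \<in> parcs G \<longleftrightarrow> (p u, p v) \<in> parcs G" if uv: "u \<in> {1..n}" "v \<in> {1..n}" for u v
    using arcs[of u v] cone_arcs[OF uv] cone_arcs[of "p u" "p v"] uv permutes_in_image[OF permV]
    by blast
  then show "p \<in> Aut G" using permV V by (simp add: Aut_def)
qed

theorem theoremV2:
  fixes n :: nat and G :: "nat pair_pre_digraph"
  assumes "strongly_uncontrollable n G"
  shows "(strongly_uncontrollable (n + 1) (cone n G) \<longleftrightarrow>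
           spectral_radius (complex_mat (laplacian_mat n G)) < real n) \<and>
         (strongly_uncontrollable (n + 1) (cone n G) \<longrightarrow> Aut G = Aut (cone n G))"
proof -
  let ?ev = "eigenvalue (complex_mat (laplacian_mat n G)) (of_nat n)"
  have G: "graph_on n G" and simple: "simple_spectrum (laplacian_mat n G)"
    using assms by (auto simp: strongly_uncontrollable_def)
  have n: "n \<ge> 2" by (rule strongly_uncontrollable_size[OF assms])
  have su: "strongly_uncontrollable (n + 1) (cone n G) \<longleftrightarrow> \<not> ?ev"
    using graph_on_cone[OF G] connected_cone[OF G] uncontrollable_cone[OF assms]
      simple_spectrum_cone_iff[OF G _ simple] n
    unfolding strongly_uncontrollable_def by auto
  moreover have "Aut G = Aut (cone n G)" if no: "\<not> ?ev"
  proof (rule equalityI[OF Aut_subset_Aut_cone[OF G] Aut_cone_subset_Aut[OF G]])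
    fix v assume "v \<in> {1..n}"
    then obtain i where i: "v = Suc i" "i < n" by (cases v) auto
    obtain j where "j < n" "j \<noteq> i" "(Suc i, Suc j) \<notin> parcs G"
      using universal_vertex_eigenvalue[OF G n i(2)] no by blast
    then show "\<exists>u \<in> {1..n}. u \<noteq> v \<and> (v, u) \<notin> parcs G"
      by (intro bexI[of _ "Suc j"]) (auto simp: i)
  qed
  ultimately show ?thesis
    using spectral_radius_laplacian_less_iff[OF G] n by auto
qed

end
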